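(* Let $(V,\omega)$ be a VOA of CFT type over $\mathbb{K}$ and let $a\in CV$. Then $\mathrm{pr}_1(a)\in J_1(V)$ and $\exp(-\mathrm{pr}_1(a)(1))\,a\in V_{\ge2}\cap CV$.
   Context: The base field $\mathbb{K}$ is $\mathbb{R}$ or $\mathbb{C}$. For a vertex algebra $V$ over $\mathbb{K}$ with vacuum vector $\mathbf{1}$, $a(n)b$ denotes the $n$-th product ($n\in\mathbb{Z}$), $a(n)\in\mathrm{End}\,V$, and $Ta=a(-2)\mathbf{1}$. A $\mathbb{Z}$-graded vertex algebra is a vertex algebra $V=\bigoplus_{n\in\mathbb{Z}}V_n$ with $V_n(k)V_m\subset V_{n+m-k-1}$ and $\mathbf{1}\in V_0$. A $\mathbb{Z}$-graded conformal vertex algebra $(V,\omega)$ is a $\mathbb{Z}$-graded vertex algebra with a distinguished $\omega\in V_2$ such that the operators $L(n)=\omega(n+1)$ satisfy $[L(n),L(m)]=(n-m)L(n+m)+\frac{1}{12}\delta_{n+m,0}(n^3-n)c$ for some $c\in\mathbb{K}$, $L(0)v=nv$ for $v\in V_n$, and $L(-1)=T$. It is a VOA of CFT type if $V=\bigoplus_{n\in\mathbb{N}}V_n$ (with $\mathbb{N}=\{0,1,2,\dots\}$), $\dim V_n<\infty$ for all $n$, and $V_0=\mathbb{K}\mathbf{1}$. $CV$ is the set of conformal vectors of $V$, i.e. of $a\in V$ such that $(V,a)$, with grading $V=\bigoplus_{n\in\mathbb{Z}}V_n^a$, $V_n^a=\{v\in V\mid a(1)v=nv\}$, is a $\mathbb{Z}$-graded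 conformal vertex algebra. $\mathrm{pr}_n:V\to V_n$ is the canonical projection, $V_{\ge n}=\bigoplus_{i\ge n}V_i$ (for the grading given by $\omega$), and $J_1(V)=\{a\in V_1\mid a(0)=0\}$. For $v\in V_1$, $v(1)$ is the $1$st-product operator of $v$; it lowers degree by one, so $\exp(v(1))$ is well defined on $V$. Here $\mathrm{pr}_1(a)(1)$ is the operator $v(1)$ with $v=\mathrm{pr}_1(a)$. *)

theory Defs
  imports Complex_Main "HOL-Library.Groups_Big_Fun"
begin

text \<open>The base fields: up to isomorphism, exactly the real and the complex numbers.\<close>

class real_or_complex = field_char_0 +
  assumes real_or_complex: "\<exists>\<phi> :: 'a \<Rightarrow> complex. inj \<phi> \<and> (range \<phi> = \<real> \<or> range \<phi> = UNIV)
    \<and> \<phi> 1 = 1 \<and> (\<forall>x y. \<phi> (x + y) = \<phi> x + \<phi> y) \<and> (\<forall>x y. \<phi> (x * y) = \<phi> x * \<phi> y)"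

instance real :: real_or_complex
proof
  show "\<exists>\<phi> :: real \<Rightarrow> complex. inj \<phi> \<and> (range \<phi> = \<real> \<or> range \<phi> = UNIV)
    \<and> \<phi> 1 = 1 \<and> (\<forall>x y. \<phi> (x + y) = \<phi> x + \<phi> y) \<and> (\<forall>x y. \<phi> (x * y) = \<phi> x * \<phi> y)"
    by (rule exI[of _ of_real]) (simp add: inj_of_real Reals_def)
qed

instance complex :: real_or_complex
proof
  show "\<exists>\<phi> :: complex \<Rightarrow> complex. inj \<phi> \<and> (range \<phi> = \<real> \<or> range \<phi> = UNIV)
    \<and> \<phi> 1 = 1 \<and> (\<forall>x y. \<phi> (x + y) = \<phi> x + \<phi> y) \<and> (\<forall>x y. \<phi> (x * y) = \<phi> x * \<phi> y)"
    by (rule exI[of _ id]) simp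
qed

text \<open>
  \<open>Y a n b\<close> is the product $a(n)b$. The last axiom is the Borcherds identity. Its sums have
  only finitely many nonzero terms, by truncation, so \<^const>\<open>Sum_any\<close> (which returns \<open>0\<close> on
  infinite supports) is the actual sum.
\<close>

locale vertex_algebra = vector_space scale
  for scale :: "'k::real_or_complex \<Rightarrow> 'v::ab_group_add \<Rightarrow> 'v" (infixr \<open>*s\<close> 75) +
  fixes Y :: "'v \<Rightarrow> int \<Rightarrow> 'v \<Rightarrow> 'v" and vac :: 'v
  assumes linear_left: "Vector_Spaces.linear scale scale (\<lambda>a. Y a n b)"
    and linear_right: "Vector_Spaces.linear scale scale (\<lambda>b. Y a n b)"
    and truncation: "\<exists>N. \<forall>n\<ge>N. Y a n b = 0"
    and vacuum: "Y vac n a = (if n = -1 then a else 0)"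
    and creation: "Y a (-1) vac = a"
    and creation_nonneg: "n \<ge> 0 \<Longrightarrow> Y a n vac = 0"
    and borcherds:
      "Sum_any (\<lambda>i::nat. (of_int p gchoose i) *s Y (Y a (r + int i) b) (p + q - int i) v) =
       Sum_any (\<lambda>i::nat. ((-1) ^ i * (of_int r gchoose i)) *s
         (Y a (p + r - int i) (Y b (q + int i) v)
          - ((-1) powi r) *s Y b (q + r - int i) (Y a (p + int i) v)))"

definition decomposition :: "(int \<Rightarrow> 'v set) \<Rightarrow> 'v \<Rightarrow> (int \<Rightarrow> 'v::ab_group_add) \<Rightarrow> bool" where
  "decomposition V v f \<longleftrightarrow> (\<forall>n. f n \<in> V n) \<and> finite {n. f n \<noteq> 0} \<and> v = (\<Sum>n | f n \<noteq> 0. f n)"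

definition proj :: "(int \<Rightarrow> 'v set) \<Rightarrow> int \<Rightarrow> 'v \<Rightarrow> 'v::ab_group_add" where
  "proj V n v = (THE f. decomposition V v f) n"

locale graded_vertex_algebra = vertex_algebra scale Y vac
  for scale :: "'k::real_or_complex \<Rightarrow> 'v::ab_group_add \<Rightarrow> 'v" (infixr \<open>*s\<close> 75)
    and Y :: "'v \<Rightarrow> int \<Rightarrow> 'v \<Rightarrow> 'v" and vac :: 'v +
  fixes V :: "int \<Rightarrow> 'v set"
  assumes subspace_grading: "subspace (V n)"
    and direct_sum: "\<exists>!f. decomposition V v f"
    and vac_degree: "vac \<in> V 0"
    and product_degree: "a \<in> V n \<Longrightarrow> b \<in> V m \<Longrightarrow> Y a k b \<in> V (n + m - k - 1)"

locale conformal_vertex_algebra = graded_vertex_algebra scale Y vac V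
  for scale :: "'k::real_or_complex \<Rightarrow> 'v::ab_group_add \<Rightarrow> 'v" (infixr \<open>*s\<close> 75)
    and Y :: "'v \<Rightarrow> int \<Rightarrow> 'v \<Rightarrow> 'v" and vac :: 'v and V :: "int \<Rightarrow> 'v set" +
  fixes \<omega> :: 'v
  assumes conformal_degree: "\<omega> \<in> V 2"
    and virasoro: "\<exists>c. \<forall>n m v.
      Y \<omega> (n + 1) (Y \<omega> (m + 1) v) - Y \<omega> (m + 1) (Y \<omega> (n + 1) v) =
        of_int (n - m) *s Y \<omega> (n + m + 1) v
        + (if n + m = 0 then (of_int (n ^ 3 - n) / 12 * c) *s v else 0)"
    and L0_grading: "v \<in> V n \<Longrightarrow> Y \<omega> 1 v = of_int n *s v"
    and Lm1_translation: "Y \<omega> 0 v = Y v (-2) vac"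

locale CFT_type_VOA = conformal_vertex_algebra +
  assumes nonneg_grading: "n < 0 \<Longrightarrow> V n = {0}"
    and finite_dimensional: "\<exists>B. finite B \<and> V n = span B"
    and degree_0: "V 0 = span {vac}"

definition CV :: "('k::real_or_complex \<Rightarrow> 'v \<Rightarrow> 'v) \<Rightarrow> ('v \<Rightarrow> int \<Rightarrow> 'v \<Rightarrow> 'v) \<Rightarrow> 'v
    \<Rightarrow> 'v::ab_group_add set" where
  "CV scale Y vac =
    {a. conformal_vertex_algebra scale Y vac (\<lambda>n. {v. Y a 1 v = scale (of_int n) v}) a}"

definition V_ge :: "('k::field \<Rightarrow> 'v \<Rightarrow> 'v) \<Rightarrow> (int \<Rightarrow> 'v set) \<Rightarrow> int
    \<Rightarrow> 'v::ab_group_add set" where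
  "V_ge scale V n = module.span scale (\<Union>i\<in>{n..}. V i)"

definition J1 :: "('v \<Rightarrow> int \<Rightarrow> 'v \<Rightarrow> 'v) \<Rightarrow> (int \<Rightarrow> 'v set) \<Rightarrow> 'v::zero set" where
  "J1 Y V = {a \<in> V 1. \<forall>b. Y a 0 b = 0}"

text \<open>
  The exponential series of a locally nilpotent operator; \<^const>\<open>Sum_any\<close> makes it \<open>0\<close> at vectors
  where infinitely many terms are nonzero. For $v$ of degree one in a VOA of CFT type the operator $v(1)$
  lowers degrees by one, hence is locally nilpotent.
\<close>

definition exp_op :: "('k::field_char_0 \<Rightarrow> 'v \<Rightarrow> 'v) \<Rightarrow> ('v \<Rightarrow> 'v) \<Rightarrow> 'v
    \<Rightarrow> 'v::ab_group_add" where
  "exp_op scale f v = Sum_any (\<lambda>k::nat. scale (1 / fact k) ((f ^^ k) v))"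

end

theory Submission imports Defs begin

text \<open>
  Write $a_n = \mathrm{pr}_n(a)$, $v = a_1$ and $D = v(1)$.

  A conformal vector satisfies $a(0) = T$. As $a_n(0)$ has degree $n - 1$ and $T$ has degree one,
  $a_2(0) = T$ and $a_n(0) = 0$ for $n \neq 2$ (\<open>proj_zeroth_product\<close>). In particular
  $v(0) = 0$, that is, $v \in J_1(V)$.

  Since $v(0) = 0$, the commutator formula makes $D$ a derivation of all products, and it is
  locally nilpotent because it lowers degrees in a grading bounded below. Hence $\exp(-D)$ is an
  automorphism of the vertex algebra, and automorphisms permute the conformal vectors
  (\<open>expf_CV\<close>). So $b = \exp(-D) a$ is a conformal vector, and it remains to show that its
  components of degrees one and zero vanish.

  In degree one the main point is \<open>first_product_degree_two\<close>: if $y \in V_2$ and $y(0) = cT$,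
  then $D y = c v$. It follows from skew symmetry and the injectivity of $T$ on $V_1$. It gives
  $D a_2 = v$. For $k \geq 2$ the vector $y = D^{k-1} a_{k+1} \in V_2$ has $y(0) = 0$, as
  $a_{k+1}(0) = 0$ and $D$ is a derivation, so $D^k a_{k+1} = 0$. Therefore
  $b_1 = \sum_k \frac{(-1)^k}{k!} D^k a_{k+1} = v - v = 0$.

  In degree zero, the eigenvalue equation $b(1) b = 2 b$ gives
  $2 b_0 = \sum_m b_{2-m}(1) b_m = b_1(1) b_1 = 0$, because $b_0$ is a multiple of the vacuum.
\<close>

section \<open>Low-order consequences of the Borcherds identity\<close>

context vertex_algebra
begin

lemma prod_left_simps [simp]:
  shows prod_add_left: "Y (x + y) n z = Y x n z + Y y n z"
    and prod_scale_left: "Y (c *s x) n z = c *s Y x n z"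
    and prod_zero_left: "Y 0 n z = 0"
    and prod_minus_left: "Y (- x) n z = - Y x n z"
    and prod_diff_left: "Y (x - y) n z = Y x n z - Y y n z"
    and prod_sum_left: "Y (sum h A) n z = (\<Sum>i\<in>A. Y (h i) n z)"
proof -
  interpret l: Vector_Spaces.linear scale scale "\<lambda>a. Y a n z" by (rule linear_left)
  show "Y (x + y) n z = Y x n z + Y y n z" "Y (c *s x) n z = c *s Y x n z" "Y 0 n z = 0"
    "Y (- x) n z = - Y x n z" "Y (x - y) n z = Y x n z - Y y n z"
    "Y (sum h A) n z = (\<Sum>i\<in>A. Y (h i) n z)"
    by (rule l.add l.scale l.zero l.neg l.diff l.sum)+
qed

lemma prod_right_simps [simp]:
  shows prod_add_right: "Y z n (x + y) = Y z n x + Y z n y"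
    and prod_scale_right: "Y z n (c *s x) = c *s Y z n x"
    and prod_zero_right: "Y z n 0 = 0"
    and prod_minus_right: "Y z n (- x) = - Y z n x"
    and prod_diff_right: "Y z n (x - y) = Y z n x - Y z n y"
    and prod_sum_right: "Y z n (sum h A) = (\<Sum>i\<in>A. Y z n (h i))"
proof -
  interpret l: Vector_Spaces.linear scale scale "\<lambda>b. Y z n b" by (rule linear_right)
  show "Y z n (x + y) = Y z n x + Y z n y" "Y z n (c *s x) = c *s Y z n x" "Y z n 0 = 0"
    "Y z n (- x) = - Y z n x" "Y z n (x - y) = Y z n x - Y z n y"
    "Y z n (sum h A) = (\<Sum>i\<in>A. Y z n (h i))"
    by (rule l.add l.scale l.zero l.neg l.diff l.sum)+
qed

text \<open>The case $p = 1$, $r = 0$ of the Borcherds identity.\<close>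

lemma commutator_one:
  "Y a 1 (Y b q v) - Y b q (Y a 1 v) = Y (Y a 0 b) (q + 1) v + Y (Y a 1 b) q v"
proof -
  have bin: "(1 :: 'k) gchoose i = (if i = 0 \<or> i = 1 then 1 else 0)" for i
  proof -
    have "(1 :: 'k) gchoose i = of_nat (1 choose i)"
      by (subst binomial_gbinomial) simp
    moreover have "1 choose i = (if i = 0 \<or> i = 1 then 1 else 0)"
      by (cases i) auto
    ultimately show ?thesis by simp
  qed
  have "Sum_any (\<lambda>i::nat. (of_int 1 gchoose i) *s Y (Y a (0 + int i) b) (1 + q - int i) v)
      = (\<Sum>i\<in>{0,1}. (of_int 1 gchoose i) *s Y (Y a (0 + int i) b) (1 + q - int i) v)"
    by (rule Sum_any.expand_superset) (auto simp: bin)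
  also have "\<dots> = Y (Y a 0 b) (q + 1) v + Y (Y a 1 b) q v"
    by (simp add: add.commute)
  finally have L: "Sum_any (\<lambda>i::nat. (of_int 1 gchoose i) *s
      Y (Y a (0 + int i) b) (1 + q - int i) v) = Y (Y a 0 b) (q + 1) v + Y (Y a 1 b) q v" .
  have "Sum_any (\<lambda>i::nat. ((-1) ^ i * (of_int 0 gchoose i)) *s
         (Y a (1 + 0 - int i) (Y b (q + int i) v)
          - ((-1) powi (0::int)) *s Y b (q + 0 - int i) (Y a (1 + int i) v)))
      = (\<Sum>i\<in>{0}. ((-1) ^ i * (of_int 0 gchoose i)) *s
         (Y a (1 + 0 - int i) (Y b (q + int i) v)
          - ((-1) powi (0::int)) *s Y b (q + 0 - int i) (Y a (1 + int i) v)))"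
    by (rule Sum_any.expand_superset) (auto simp: gbinomial_0_left)
  also have "\<dots> = Y a 1 (Y b q v) - Y b q (Y a 1 v)"
    by simp
  finally show ?thesis
    using L borcherds[of 1 a 0 b q v] by simp
qed

text \<open>
  Skew symmetry: the case $p = -1$, $q = 0$ of the Borcherds identity at the vacuum. The usual
  divided power $T^i / i!$ of the translation operator appears as $x \mapsto x(-1-i)\mathbf{1}$.
\<close>

lemma skew_symmetry:
  "Y b r a = Sum_any (\<lambda>i::nat. (- ((-1) powi r) * (-1) ^ i) *s Y (Y a (r + int i) b) (- 1 - int i) vac)"
proof -
  have bin: "(- 1 :: 'k) gchoose i = (-1) ^ i" for i
    using gbinomial_minus[of "1::'k" i] binomial_gbinomial[of i i, where 'a='k] by simp
  have "Sum_any (\<lambda>i::nat. ((-1) ^ i * (of_int r gchoose i)) *s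
         (Y a (- 1 + r - int i) (Y b (0 + int i) vac)
          - ((-1) powi r) *s Y b (0 + r - int i) (Y a (- 1 + int i) vac)))
      = (\<Sum>i\<in>{0}. ((-1) ^ i * (of_int r gchoose i)) *s
         (Y a (- 1 + r - int i) (Y b (0 + int i) vac)
          - ((-1) powi r) *s Y b (0 + r - int i) (Y a (- 1 + int i) vac)))"
  proof (rule Sum_any.expand_superset)
    have "Y a (- 1 + int i) vac = 0" if "i \<noteq> 0" for i
      using that by (intro creation_nonneg) simp
    then have "Y b (0 + r - int i) (Y a (- 1 + int i) vac) = 0" if "i \<noteq> 0" for i
      using that by simp
    moreover have "Y b (0 + int i) vac = 0" for i
      by (simp add: creation_nonneg)
    ultimately show "{i. ((-1) ^ i * (of_int r gchoose i)) *s
         (Y a (- 1 + r - int i) (Y b (0 + int i) vac)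
          - ((-1) powi r) *s Y b (0 + r - int i) (Y a (- 1 + int i) vac)) \<noteq> 0} \<subseteq> {0}"
      by (auto simp del: add_0_left)
  qed simp
  also have "\<dots> = - ((-1) powi r) *s Y b r a"
    by (simp add: creation creation_nonneg)
  finally have R: "- ((-1) powi r) *s Y b r a =
      Sum_any (\<lambda>i::nat. (-1) ^ i *s Y (Y a (r + int i) b) (- 1 - int i) vac)"
    using borcherds[of "- 1" a r b 0 vac] by (simp add: bin)
  obtain N where N: "\<And>n. n \<ge> N \<Longrightarrow> Y a n b = 0"
    using truncation by blast
  define M where "M = nat (N - r)"
  have M: "Y a (r + int i) b = 0" if "i \<ge> M" for i
    using that by (intro N) (auto simp: M_def)
  have S: "Sum_any (\<lambda>i::nat. (c * (-1) ^ i) *s Y (Y a (r + int i) b) (- 1 - int i) vac)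
      = (\<Sum>i<M. (c * (-1) ^ i) *s Y (Y a (r + int i) b) (- 1 - int i) vac)" for c
  proof (rule Sum_any.expand_superset)
    have "i < M" if "Y (Y a (r + int i) b) (- 1 - int i) vac \<noteq> 0" for i
      using that M[of i] by (cases "M \<le> i") simp_all
    then show "{i. (c * (-1) ^ i) *s Y (Y a (r + int i) b) (- 1 - int i) vac \<noteq> 0} \<subseteq> {..<M}"
      by auto
  qed simp
  have sq: "((-1) powi r) * ((-1) powi r) = (1::'k)"
    by (simp flip: power_int_mult_distrib)
  have "Y b r a = - ((-1) powi r) *s (- ((-1) powi r) *s Y b r a)"
    by (simp add: sq)
  also have "\<dots> = - ((-1) powi r) *s
      (\<Sum>i<M. (-1) ^ i *s Y (Y a (r + int i) b) (- 1 - int i) vac)"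
    using R S[of 1] by simp
  also have "\<dots> = (\<Sum>i<M. (- ((-1) powi r) * (-1) ^ i) *s Y (Y a (r + int i) b) (- 1 - int i) vac)"
    by (simp add: scale_sum_right sum_negf)
  also have "\<dots> = Sum_any (\<lambda>i::nat.
      (- ((-1) powi r) * (-1) ^ i) *s Y (Y a (r + int i) b) (- 1 - int i) vac)"
    by (rule S[symmetric])
  finally show ?thesis .
qed

end

section \<open>Automorphisms and conformal vectors\<close>

context vertex_algebra
begin

text \<open>
  The eigenspaces of $(g a)(1)$ are the images under $g$ of the eigenspaces of $a(1)$, so every
  axiom transports along the inverse \<open>h\<close> of $g$.
\<close>

lemma CV_automorphism:
  assumes lin: "Vector_Spaces.linear scale scale g" and bij: "bij g"
    and hom: "\<And>x n y. g (Y x n y) = Y (g x) n (g y)" and vac: "g vac = vac"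
    and a: "a \<in> CV scale Y vac"
  shows "g a \<in> CV scale Y vac"
proof -
  define W where "W = (\<lambda>n::int. {v. Y a 1 v = of_int n *s v})"
  define W' where "W' = (\<lambda>n::int. {v. Y (g a) 1 v = of_int n *s v})"
  interpret A: conformal_vertex_algebra scale Y vac W a
    using a by (simp add: CV_def W_def)
  interpret g: Vector_Spaces.linear scale scale g by (rule lin)
  define h where "h = inv g"
  have gh [simp]: "g (h x) = x" for x
    using bij by (simp add: h_def bij_is_surj surj_f_inv_f)
  have hg [simp]: "h (g x) = x" for x
    using bij by (simp add: h_def bij_is_inj)
  have h0: "h x = 0 \<longleftrightarrow> x = 0" for x
    by (metis gh hg g.zero)
  have W'_iff: "x \<in> W' n \<longleftrightarrow> h x \<in> W n" for x n
  proof -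
    have "Y (g a) 1 x = g (Y a 1 (h x))" by (simp add: hom)
    moreover have "of_int n *s x = g (of_int n *s h x)" by (simp add: g.scale)
    ultimately show ?thesis unfolding W_def W'_def by simp (metis hg)
  qed
  have hY: "h (Y x n y) = Y (h x) n (h y)" for x n y
    by (metis gh hg hom)
  have dec: "decomposition W' x f \<longleftrightarrow> decomposition W (h x) (\<lambda>n. h (f n))" for x f
  proof -
    have "x = (\<Sum>n | f n \<noteq> 0. f n) \<longleftrightarrow> h x = (\<Sum>n | f n \<noteq> 0. h (f n))"
    proof -
      have "g (\<Sum>n | f n \<noteq> 0. h (f n)) = (\<Sum>n | f n \<noteq> 0. f n)"
        by (simp add: g.sum)
      then show ?thesis by (metis gh hg)
    qed
    then show ?thesis by (simp add: decomposition_def W'_iff h0)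
  qed
  have "conformal_vertex_algebra scale Y vac W' (g a)"
  proof
    show "subspace (W' n)" for n
      by (rule subspaceI) (auto simp: W'_def scale_right_distrib mult.commute)
    show "\<exists>!f. decomposition W' x f" for x
    proof -
      obtain f where f: "decomposition W (h x) f" and
        uniq: "\<And>f'. decomposition W (h x) f' \<Longrightarrow> f' = f"
        using A.direct_sum by blast
      show ?thesis
      proof (rule ex1I)
        show "decomposition W' x (\<lambda>n. g (f n))" by (simp add: dec f)
        show "f' = (\<lambda>n. g (f n))" if "decomposition W' x f'" for f'
          using uniq[OF that[unfolded dec]] by (metis gh)
      qed
    qed
    have hvac: "h vac = vac" by (metis hg vac)
    show "vac \<in> W' 0" by (simp add: W'_iff hvac A.vac_degree)
    show "Y x k y \<in> W' (n + m - k - 1)" if "x \<in> W' n" "y \<in> W' m" for x y n m k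
      using that by (simp add: W'_iff hY A.product_degree)
    show "g a \<in> W' 2" by (simp add: W'_iff A.conformal_degree)
    have ga: "Y (g a) n x = g (Y a n (h x))" for n x by (simp add: hom)
    obtain c where c: "Y a (n + 1) (Y a (m + 1) v) - Y a (m + 1) (Y a (n + 1) v) =
        of_int (n - m) *s Y a (n + m + 1) v
        + (if n + m = 0 then (of_int (n ^ 3 - n) / 12 * c) *s v else 0)" for n m v
      using A.virasoro by blast
    have "Y (g a) (n + 1) (Y (g a) (m + 1) v) - Y (g a) (m + 1) (Y (g a) (n + 1) v) =
        of_int (n - m) *s Y (g a) (n + m + 1) v
        + (if n + m = 0 then (of_int (n ^ 3 - n) / 12 * c) *s v else 0)" for n m v
    proof -
      have "Y (g a) (n + 1) (Y (g a) (m + 1) v) - Y (g a) (m + 1) (Y (g a) (n + 1) v)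
          = g (Y a (n + 1) (Y a (m + 1) (h v)) - Y a (m + 1) (Y a (n + 1) (h v)))"
        by (simp only: ga hg g.diff)
      also have "\<dots> = of_int (n - m) *s Y (g a) (n + m + 1) v
        + (if n + m = 0 then (of_int (n ^ 3 - n) / 12 * c) *s v else 0)"
        unfolding c ga by (simp only: g.add g.scale gh g.zero split: if_split) simp
      finally show ?thesis .
    qed
    then show "\<exists>c. \<forall>n m v. Y (g a) (n + 1) (Y (g a) (m + 1) v)
        - Y (g a) (m + 1) (Y (g a) (n + 1) v) =
        of_int (n - m) *s Y (g a) (n + m + 1) v
        + (if n + m = 0 then (of_int (n ^ 3 - n) / 12 * c) *s v else 0)"
      by blast
    show "Y (g a) 1 x = of_int n *s x" if "x \<in> W' n" for x n
      using that by (simp add: W'_def)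
    show "Y (g a) 0 x = Y x (-2) vac" for x
      using A.Lm1_translation[of "h x"] by (metis hom gh vac)
  qed
  then show ?thesis by (simp add: CV_def W'_def)
qed

end

section \<open>Exponentials of locally nilpotent derivations\<close>

text \<open>The Cauchy product of two finite sums, for bi-indexed terms that vanish outside a square.\<close>

lemma sum_square_eq_diagonals:
  fixes h :: "nat \<Rightarrow> nat \<Rightarrow> 'a::comm_monoid_add"
  assumes "\<And>i j. i \<ge> N \<or> j \<ge> N \<Longrightarrow> h i j = 0"
  shows "(\<Sum>i<N. \<Sum>j<N. h i j) = (\<Sum>n<2 * N. \<Sum>k\<le>n. h k (n - k))"
proof -
  have "(\<Sum>n<2 * N. \<Sum>k\<le>n. h k (n - k)) = (\<Sum>(i,j)\<in>{(i,j). i + j < 2 * N}. h i j)"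
    by (rule sum.triangle_reindex[symmetric])
  also have "\<dots> = (\<Sum>(i,j)\<in>{..<N} \<times> {..<N}. h i j)"
  proof (rule sum.mono_neutral_right)
    show "finite {(i, j). i + j < 2 * N}"
      by (rule finite_subset[of _ "{..<2 * N} \<times> {..<2 * N}"]) auto
  qed (auto simp: not_less intro!: assms)
  also have "\<dots> = (\<Sum>i<N. \<Sum>j<N. h i j)"
    by (simp add: sum.cartesian_product)
  finally show ?thesis by simp
qed

text \<open>
  Local nilpotency makes the exponential series a finite sum at every vector. The general Leibniz
  rule for divided powers shows that the exponential of a derivation preserves all products.
\<close>

locale locally_nilpotent_derivation = vertex_algebra scale Y vac
  for scale :: "'k::real_or_complex \<Rightarrow> 'v::ab_group_add \<Rightarrow> 'v" (infixr \<open>*s\<close> 75)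
    and Y :: "'v \<Rightarrow> int \<Rightarrow> 'v \<Rightarrow> 'v" and vac :: 'v +
  fixes f :: "'v \<Rightarrow> 'v"
  assumes linear_f: "Vector_Spaces.linear scale scale f"
    and derivation: "f (Y x n y) = Y (f x) n y + Y x n (f y)"
    and locally_nilpotent: "\<exists>N. (f ^^ N) x = 0"
begin

sublocale f: Vector_Spaces.linear scale scale f by (rule linear_f)

text \<open>The divided power $f^k / k!$.\<close>

definition dpow :: "nat \<Rightarrow> 'v \<Rightarrow> 'v" where
  "dpow k x = (1 / fact k) *s (f ^^ k) x"

abbreviation expf :: "'v \<Rightarrow> 'v" where
  "expf \<equiv> exp_op scale f"

lemma funpow_add_distrib: "(f ^^ k) (x + y) = (f ^^ k) x + (f ^^ k) y"
  by (induction k) (simp_all add: f.add)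

lemma funpow_scale: "(f ^^ k) (c *s x) = c *s (f ^^ k) x"
  by (induction k) (simp_all add: f.scale)

lemma funpow_zero [simp]: "(f ^^ k) 0 = 0"
  by (induction k) simp_all

lemma dpow_0 [simp]: "dpow 0 x = x"
  by (simp add: dpow_def)

lemma f_dpow: "f (dpow k x) = of_nat (Suc k) *s dpow (Suc k) x"
proof -
  have "(1 :: 'k) / fact k = of_nat (Suc k) * (1 / fact (Suc k))"
    by (simp only: fact_Suc of_nat_mult) (simp del: of_nat_Suc)
  then show ?thesis by (simp only: dpow_def f.scale scale_scale funpow.simps comp_apply)
qed

lemma dpow_Leibniz: "dpow n (Y x m y) = (\<Sum>k\<le>n. Y (dpow k x) m (dpow (n - k) y))"
proof (induction n)
  case 0
  show ?case by simp
next
  case (Suc n)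
  \<comment> \<open>The weights $k$ and $n + 1 - k$ of the $k$-th term add up to $n + 1$,
    which is cancelled at the end.\<close>
  let ?t = "\<lambda>k. Y (dpow k x) m (dpow (Suc n - k) y)"
  have "of_nat (Suc n) *s dpow (Suc n) (Y x m y) = f (\<Sum>k\<le>n. Y (dpow k x) m (dpow (n - k) y))"
    by (simp only: f_dpow[symmetric] Suc.IH)
  also have "\<dots> = (\<Sum>k\<le>n. of_nat (Suc k) *s ?t (Suc k)) + (\<Sum>k\<le>n. of_nat (Suc n - k) *s ?t k)"
    by (simp add: f.sum derivation f_dpow sum.distrib Suc_diff_le del: of_nat_Suc)
  also have "(\<Sum>k\<le>n. of_nat (Suc k) *s ?t (Suc k)) = (\<Sum>k\<le>Suc n. of_nat k *s ?t k)"
    by (simp add: sum.atMost_Suc_shift del: sum.atMost_Suc)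
  also have "(\<Sum>k\<le>n. of_nat (Suc n - k) *s ?t k) = (\<Sum>k\<le>Suc n. of_nat (Suc n - k) *s ?t k)"
    by simp
  also have "(\<Sum>k\<le>Suc n. of_nat k *s ?t k) + (\<Sum>k\<le>Suc n. of_nat (Suc n - k) *s ?t k)
      = (\<Sum>k\<le>Suc n. of_nat (Suc n) *s ?t k)"
    unfolding sum.distrib[symmetric] scale_left_distrib[symmetric] of_nat_add[symmetric]
    by (intro sum.cong refl) simp
  also have "\<dots> = of_nat (Suc n) *s (\<Sum>k\<le>Suc n. ?t k)"
    by (simp only: scale_sum_right)
  finally show ?case
    by (simp only: scale_cancel_left of_nat_eq_0_iff) simp
qed

lemma eventually_zero: obtains N where "\<And>k. k \<ge> N \<Longrightarrow> (f ^^ k) x = 0"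
proof -
  obtain N where N: "(f ^^ N) x = 0" using locally_nilpotent by blast
  have "(f ^^ k) x = 0" if "k \<ge> N" for k
  proof -
    have "(f ^^ k) x = (f ^^ (k - N)) ((f ^^ N) x)"
      using that by (simp flip: comp_apply[of "f ^^ (k - N)" "f ^^ N"] funpow_add)
    then show ?thesis
      using N by simp
  qed
  then show thesis by (rule that)
qed

lemma expf_eq_sum:
  assumes "\<And>k. k \<ge> N \<Longrightarrow> (f ^^ k) x = 0"
  shows "expf x = (\<Sum>k<N. dpow k x)"
  unfolding exp_op_def dpow_def
  by (rule Sum_any.expand_superset) (use assms not_less in auto)

lemma linear_expf: "Vector_Spaces.linear scale scale expf"
proof -
  have "expf (x + y) = expf x + expf y" for x y
  proof -
    obtain M N where M: "\<And>k. k \<ge> M \<Longrightarrow> (f ^^ k) x = 0" and N: "\<And>k. k \<ge> N \<Longrightarrow> (f ^^ k) y = 0"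
      by (metis eventually_zero)
    have z: "(f ^^ k) (x + y) = (f ^^ k) x + (f ^^ k) y" for k
      by (rule funpow_add_distrib)
    have "expf x = (\<Sum>k<max M N. dpow k x)" "expf y = (\<Sum>k<max M N. dpow k y)"
      "expf (x + y) = (\<Sum>k<max M N. dpow k (x + y))"
      by (rule expf_eq_sum; simp add: M N z)+
    then show ?thesis
      by (simp add: sum.distrib dpow_def z scale_right_distrib)
  qed
  moreover have "expf (c *s x) = c *s expf x" for c x
  proof -
    obtain M where M: "\<And>k. k \<ge> M \<Longrightarrow> (f ^^ k) x = 0"
      by (metis eventually_zero)
    have z: "(f ^^ k) (c *s x) = c *s (f ^^ k) x" for k
      by (rule funpow_scale)
    have "expf x = (\<Sum>k<M. dpow k x)" "expf (c *s x) = (\<Sum>k<M. dpow k (c *s x))"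
      by (rule expf_eq_sum; simp add: M z)+
    then show ?thesis
      by (simp add: scale_sum_right dpow_def z mult.commute)
  qed
  ultimately show ?thesis
    by unfold_locales
qed

lemma expf_prod: "expf (Y x m y) = Y (expf x) m (expf y)"
proof -
  obtain M M' where M: "\<And>k. k \<ge> M \<Longrightarrow> (f ^^ k) x = 0" and M': "\<And>k. k \<ge> M' \<Longrightarrow> (f ^^ k) y = 0"
    by (metis eventually_zero)
  define N where "N = max M M'"
  have N: "dpow k x = 0" "dpow k y = 0" if "k \<ge> N" for k
    using M M' that by (auto simp: N_def dpow_def)
  have L: "dpow n (Y x m y) = 0" if "n \<ge> 2 * N" for n
    unfolding dpow_Leibniz
  proof (intro sum.neutral ballI)
    fix k assume "k \<in> {..n}"
    then have "k \<ge> N \<or> n - k \<ge> N" using that by auto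
    then show "Y (dpow k x) m (dpow (n - k) y) = 0" by (auto simp: N)
  qed
  have "expf (Y x m y) = (\<Sum>n<2 * N. dpow n (Y x m y))"
    by (rule expf_eq_sum) (use L in \<open>simp add: dpow_def\<close>)
  also have "\<dots> = (\<Sum>i<N. \<Sum>j<N. Y (dpow i x) m (dpow j y))"
    unfolding dpow_Leibniz by (rule sum_square_eq_diagonals[symmetric]) (auto simp: N)
  also have "\<dots> = Y (\<Sum>i<N. dpow i x) m (\<Sum>j<N. dpow j y)"
    by (simp only: prod_sum_left, simp only: prod_sum_right)
  also have "\<dots> = Y (expf x) m (expf y)"
    by (subst (1 2) expf_eq_sum[of N]) (auto simp: N_def M M')
  finally show ?thesis .
qed

text \<open>A derivation kills the vacuum, since $f(\mathbf{1}(-1)\mathbf{1}) = 2 f(\mathbf{1})$.\<close>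

lemma f_vac: "f vac = 0"
proof -
  have "f (Y vac (-1) vac) = Y (f vac) (-1) vac + Y vac (-1) (f vac)"
    by (rule derivation)
  then show ?thesis by (simp add: vacuum creation)
qed

lemma expf_vac: "expf vac = vac"
proof -
  have "(f ^^ k) vac = 0" if "k \<ge> 1" for k
    using that by (cases k) (simp_all add: funpow_Suc_right f_vac del: funpow.simps)
  then have "expf vac = (\<Sum>k<1. dpow k vac)" by (rule expf_eq_sum)
  then show ?thesis by simp
qed

lemma funpow_uminus: "((\<lambda>x. - f x) ^^ k) x = (-1) ^ k *s (f ^^ k) x"
  by (induction k) (simp_all add: f.scale)

lemma derivation_uminus: "locally_nilpotent_derivation scale Y vac (\<lambda>x. - f x)"
proof
  show "- f (x + y) = - f x + - f y" "- f (c *s x) = c *s - f x" for x y c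
    by (simp_all add: f.add f.scale)
  show "- f (Y x n y) = Y (- f x) n y + Y x n (- f y)" for x n y
    by (simp add: derivation)
  show "\<exists>N. ((\<lambda>x. - f x) ^^ N) x = 0" for x
    using locally_nilpotent[of x] by (auto simp: funpow_uminus)
qed

lemma expf_inverse: "expf (exp_op scale (\<lambda>x. - f x) x) = x"
proof -
  interpret m: locally_nilpotent_derivation scale Y vac "\<lambda>x. - f x"
    by (rule derivation_uminus)
  obtain M where M: "\<And>k. k \<ge> M \<Longrightarrow> (f ^^ k) x = 0"
    by (metis eventually_zero)
  define N where "N = Suc M"
  have N: "(f ^^ k) x = 0" if "k \<ge> N" for k using that by (simp add: N_def M)
  interpret e: Vector_Spaces.linear scale scale expf by (rule linear_expf)
  have *: "(f ^^ i) ((f ^^ j) x) = (f ^^ (i + j)) x" for i j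
    by (simp add: funpow_add)
  let ?c = "\<lambda>i j. (1 / fact i) * ((-1) ^ j / fact j) :: 'k"
  have "exp_op scale (\<lambda>x. - f x) x = (\<Sum>j<N. m.dpow j x)"
    by (rule m.expf_eq_sum) (simp add: funpow_uminus N)
  then have "expf (exp_op scale (\<lambda>x. - f x) x)
      = (\<Sum>j<N. ((-1) ^ j / fact j) *s expf ((f ^^ j) x))"
    by (simp add: e.sum e.scale m.dpow_def funpow_uminus)
  also have "\<dots> = (\<Sum>j<N. \<Sum>i<N. ?c i j *s (f ^^ (i + j)) x)"
  proof (intro sum.cong refl)
    fix j
    have "expf ((f ^^ j) x) = (\<Sum>i<N. dpow i ((f ^^ j) x))"
      by (rule expf_eq_sum) (simp only: *, simp add: N)
    then show "((-1) ^ j / fact j) *s expf ((f ^^ j) x) = (\<Sum>i<N. ?c i j *s (f ^^ (i + j)) x)"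
      by (simp add: dpow_def * scale_sum_right mult.commute)
  qed
  also have "\<dots> = (\<Sum>i<N. \<Sum>j<N. ?c i j *s (f ^^ (i + j)) x)"
    by (rule sum.swap)
  also have "\<dots> = (\<Sum>n<2 * N. \<Sum>k\<le>n. ?c k (n - k) *s (f ^^ (k + (n - k))) x)"
    by (rule sum_square_eq_diagonals) (auto simp: N)
  also have "\<dots> = (\<Sum>n<2 * N. (\<Sum>k\<le>n. ?c k (n - k)) *s (f ^^ n) x)"
    unfolding scale_sum_left by (intro sum.cong refl) simp
  also have "\<dots> = (\<Sum>n\<in>{0}. (\<Sum>k\<le>n. ?c k (n - k)) *s (f ^^ n) x)"
  proof (rule sum.mono_neutral_right)
    show "\<forall>n\<in>{..<2 * N} - {0}. (\<Sum>k\<le>n. ?c k (n - k)) *s (f ^^ n) x = 0"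
    proof
      fix n assume "n \<in> {..<2 * N} - {0}"
      then have "n > 0" by simp
      have "(\<Sum>k\<le>n. ?c k (n - k)) = (\<Sum>k\<le>n. of_nat (n choose k) * 1 ^ k * (-1) ^ (n - k)) / fact n"
        unfolding sum_divide_distrib by (intro sum.cong refl) (simp add: binomial_fact)
      also have "\<dots> = (1 + (-1)) ^ n / fact n" by (simp only: binomial_ring)
      finally show "(\<Sum>k\<le>n. ?c k (n - k)) *s (f ^^ n) x = 0"
        using \<open>n > 0\<close> by simp
    qed
  qed (auto simp: N_def)
  finally show ?thesis by simp
qed

lemma bij_expf: "bij expf"
proof -
  interpret m: locally_nilpotent_derivation scale Y vac "\<lambda>x. - f x"
    by (rule derivation_uminus)
  show ?thesis
  proof (rule o_bij)
    show "exp_op scale (\<lambda>x. - f x) \<circ> expf = id"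
      using m.expf_inverse by (simp add: fun_eq_iff)
    show "expf \<circ> exp_op scale (\<lambda>x. - f x) = id"
      using expf_inverse by (simp add: fun_eq_iff)
  qed
qed

lemma expf_CV: "a \<in> CV scale Y vac \<Longrightarrow> expf a \<in> CV scale Y vac"
  by (rule CV_automorphism[OF linear_expf bij_expf expf_prod expf_vac])

end

section \<open>Homogeneous components\<close>

lemma decompositionI:
  assumes "\<And>n. f n \<in> V n" "finite A" "{n. f n \<noteq> 0} \<subseteq> A" "x = sum f A"
  shows "decomposition V x f"
proof -
  have "sum f A = (\<Sum>n | f n \<noteq> 0. f n)"
    by (rule sum.mono_neutral_right) (use assms in auto)
  then show ?thesis
    using assms finite_subset[OF assms(3,2)] by (simp add: decomposition_def)
qed

context graded_vertex_algebra
begin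

lemma decomposition_proj: "decomposition V x (\<lambda>n. proj V n x)"
  unfolding proj_def using theI'[OF direct_sum] by simp

lemma proj_eqI: "decomposition V x f \<Longrightarrow> proj V n x = f n"
  using direct_sum[of x] decomposition_proj[of x] by metis

lemma proj_in: "proj V n x \<in> V n"
  and finite_proj: "finite {n. proj V n x \<noteq> 0}"
  and sum_proj: "(\<Sum>n | proj V n x \<noteq> 0. proj V n x) = x"
  using decomposition_proj[of x] by (simp_all add: decomposition_def)

lemma proj_homogeneous:
  assumes "x \<in> V m"
  shows "proj V n x = (if n = m then x else 0)"
  by (rule proj_eqI, rule decompositionI[where A = "{m}"])
    (use assms subspace_grading in \<open>auto simp: subspace_0\<close>)

lemma proj_add: "proj V n (x + y) = proj V n x + proj V n y"
proof -
  have "x = (\<Sum>n\<in>{n. proj V n x \<noteq> 0} \<union> {n. proj V n y \<noteq> 0}. proj V n x)"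
    by (subst sum_proj[of x, symmetric], rule sum.mono_neutral_left) (auto simp: finite_proj)
  moreover have "y = (\<Sum>n\<in>{n. proj V n x \<noteq> 0} \<union> {n. proj V n y \<noteq> 0}. proj V n y)"
    by (subst sum_proj[of y, symmetric], rule sum.mono_neutral_left) (auto simp: finite_proj)
  ultimately have "x + y = (\<Sum>n\<in>{n. proj V n x \<noteq> 0} \<union> {n. proj V n y \<noteq> 0}.
      proj V n x + proj V n y)"
    unfolding sum.distrib by (rule arg_cong2)
  then show ?thesis
    by (intro proj_eqI decompositionI[where A = "{n. proj V n x \<noteq> 0} \<union> {n. proj V n y \<noteq> 0}"])
      (auto simp: finite_proj proj_in subspace_add[OF subspace_grading])
qed

lemma proj_scale: "proj V n (c *s x) = c *s proj V n x"
proof (rule proj_eqI, rule decompositionI[where A = "{n. proj V n x \<noteq> 0}"])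
  show "c *s x = (\<Sum>n\<in>{n. proj V n x \<noteq> 0}. c *s proj V n x)"
    by (simp add: sum_proj flip: scale_sum_right)
qed (auto simp: finite_proj proj_in subspace_scale[OF subspace_grading])

lemma linear_proj: "Vector_Spaces.linear scale scale (proj V n)"
  by unfold_locales (rule proj_add proj_scale)+

sublocale proj: Vector_Spaces.linear scale scale "proj V n" for n
  by (rule linear_proj)

lemma proj_prod_homogeneous_right:
  assumes "y \<in> V m"
  shows "proj V k (Y x j y) = Y (proj V (k - m + j + 1) x) j y"
proof -
  have "proj V k (Y x j y) = (\<Sum>n | proj V n x \<noteq> 0. proj V k (Y (proj V n x) j y))"
    by (subst sum_proj[of x, symmetric]) (simp only: prod_sum_left proj.sum)
  also have "\<dots> = (\<Sum>n | proj V n x \<noteq> 0.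
      if n = k - m + j + 1 then Y (proj V n x) j y else 0)"
    by (intro sum.cong refl, subst proj_homogeneous[OF product_degree[OF proj_in assms]]) auto
  also have "\<dots> = Y (proj V (k - m + j + 1) x) j y"
    by (simp add: finite_proj)
  finally show ?thesis .
qed

lemma proj_prod_homogeneous_left:
  assumes "x \<in> V m"
  shows "proj V k (Y x j y) = Y x j (proj V (k - m + j + 1) y)"
proof -
  have "proj V k (Y x j y) = (\<Sum>n | proj V n y \<noteq> 0. proj V k (Y x j (proj V n y)))"
    by (subst sum_proj[of y, symmetric]) (simp only: prod_sum_right proj.sum)
  also have "\<dots> = (\<Sum>n | proj V n y \<noteq> 0.
      if n = k - m + j + 1 then Y x j (proj V n y) else 0)"
    by (intro sum.cong refl, subst proj_homogeneous[OF product_degree[OF assms proj_in]]) auto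
  also have "\<dots> = Y x j (proj V (k - m + j + 1) y)"
    by (simp add: finite_proj)
  finally show ?thesis .
qed

text \<open>
  If $a(0) = T$, then comparing degrees gives $a_2(0) = T$ and $a_n(0) = 0$ for $n \neq 2$, since
  $T$ raises degrees by one and $a_n(0)$ raises them by $n - 1$.
\<close>

lemma proj_zeroth_product:
  assumes "\<And>w. Y a 0 w = Y w (-2) vac"
  shows "Y (proj V n a) 0 w = (if n = 2 then Y w (-2) vac else 0)"
proof -
  have hom: "Y (proj V n a) 0 y = (if n = 2 then Y y (-2) vac else 0)" if "y \<in> V m" for y m
  proof -
    have "Y y (-2) vac \<in> V (m + 1)"
      using product_degree[OF that vac_degree, of "-2"] by (simp add: add.commute)
    then have "proj V (n + m - 1) (Y a 0 y) = (if n = 2 then Y y (-2) vac else 0)"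
      by (simp add: assms proj_homogeneous)
    then show ?thesis
      by (simp add: proj_prod_homogeneous_right[OF that])
  qed
  have "Y (proj V n a) 0 w = (\<Sum>k | proj V k w \<noteq> 0. Y (proj V n a) 0 (proj V k w))"
    by (subst sum_proj[of w, symmetric]) (simp only: prod_sum_right)
  also have "\<dots> = (\<Sum>k | proj V k w \<noteq> 0. if n = 2 then Y (proj V k w) (-2) vac else 0)"
    by (intro sum.cong refl hom[OF proj_in])
  also have "\<dots> = (if n = 2 then Y w (-2) vac else 0)"
    by (simp add: sum_proj flip: prod_sum_left)
  finally show ?thesis .
qed

end

section \<open>Vertex operator algebras of CFT type\<close>

context CFT_type_VOA
begin

lemma negative_degree: "x \<in> V n \<Longrightarrow> n < 0 \<Longrightarrow> x = 0"
  using nonneg_grading by auto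

lemma degree_zero: "x \<in> V 0 \<Longrightarrow> \<exists>c. x = c *s vac"
  using degree_0 by (auto simp: span_singleton)

lemma translation_degree_nonpos:
  assumes "x \<in> V n" "n \<le> 0" "i \<noteq> 0"
  shows "Y x (- 1 - int i) vac = 0"
proof (cases "n = 0")
  case True
  then obtain c where "x = c *s vac" using degree_zero assms(1) by blast
  then show ?thesis using assms(3) by (simp add: vacuum)
next
  case False
  then have "x = 0" using negative_degree assms by force
  then show ?thesis by simp
qed

text \<open>
  On $V_1$ one has $2 L(0) = [L(1), L(-1)] = L(1) T - T L(1)$, and $L(1)$ maps $V_1$ to $V_0$,
  where $T$ vanishes.
\<close>

lemma translation_inj_degree_one:
  assumes u: "u \<in> V 1" and Tu: "Y u (-2) vac = 0"
  shows "u = 0"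
proof -
  have "Y \<omega> 2 u \<in> V 0"
    using product_degree[OF conformal_degree u, of 2] by simp
  then have "Y \<omega> 0 (Y \<omega> 2 u) = 0"
    using translation_degree_nonpos[of _ 0 1] by (simp add: Lm1_translation)
  moreover have "Y \<omega> 0 u = 0"
    by (simp add: Lm1_translation Tu)
  moreover obtain c where "Y \<omega> (1 + 1) (Y \<omega> (-1 + 1) u) - Y \<omega> (-1 + 1) (Y \<omega> (1 + 1) u) =
        of_int (1 - (-1)) *s Y \<omega> (1 + (-1) + 1) u
        + (if 1 + (-1) = (0::int) then (of_int (1 ^ 3 - 1) / 12 * c) *s u else 0)"
    using virasoro by blast
  ultimately have "2 *s u = 0"
    by (simp add: L0_grading[OF u])
  then show ?thesis by simp
qed

text \<open>
  Here $v(0) = 0$ and $y(0) = c T$. Skew symmetry gives $v(1) y = y(1) v$ and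
  $0 = v(0) y = - y(0) v + T\, y(1) v$, as $T$ vanishes on $V_0$. Hence $T (y(1) v - c v) = 0$.
\<close>

lemma first_product_degree_two:
  assumes v: "v \<in> V 1" "\<And>w. Y v 0 w = 0"
    and y: "y \<in> V 2" "\<And>w. Y y 0 w = c *s Y w (-2) vac"
  shows "Y v 1 y = c *s v"
proof -
  have deg: "Y y (r + int i) v \<in> V (2 - r - int i)" for r i
    using product_degree[OF y(1) v(1), of "r + int i"] by (simp add: algebra_simps)
  have "Y v 1 y = (\<Sum>i\<in>{0}. (- ((-1) powi 1) * (-1) ^ i) *s Y (Y y (1 + int i) v) (- 1 - int i) vac)"
    unfolding skew_symmetry[of v 1 y]
  proof (rule Sum_any.expand_superset)
    have "Y (Y y (1 + int i) v) (- 1 - int i) vac = 0" if "i \<noteq> 0" for i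
      by (rule translation_degree_nonpos[OF deg]) (use that in auto)
    then show "{i. (- ((-1) powi 1) * (-1) ^ i) *s Y (Y y (1 + int i) v) (- 1 - int i) vac \<noteq> 0}
        \<subseteq> {0}" by auto
  qed simp
  then have one: "Y v 1 y = Y y 1 v"
    by (simp add: creation)
  have "Y v 0 y = (\<Sum>i\<in>{0,1}. (- ((-1) powi 0) * (-1) ^ i) *s Y (Y y (0 + int i) v) (- 1 - int i) vac)"
    unfolding skew_symmetry[of v 0 y]
  proof (rule Sum_any.expand_superset)
    have "Y (Y y (0 + int i) v) (- 1 - int i) vac = 0" if "i \<noteq> 0" "i \<noteq> 1" for i
      by (rule translation_degree_nonpos[OF deg]) (use that in auto)
    then show "{i. (- ((-1) powi 0) * (-1) ^ i) *s Y (Y y (0 + int i) v) (- 1 - int i) vac \<noteq> 0}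
        \<subseteq> {0,1}" by (auto simp del: add_0_left)
  qed simp
  then have "0 = - Y y 0 v + Y (Y y 1 v) (-2) vac"
    by (simp add: creation v(2))
  then have "Y (Y y 1 v - c *s v) (-2) vac = 0"
    by (simp add: y(2))
  moreover have "Y y 1 v - c *s v \<in> V 1"
    using deg[of 0 1] v(1) by (simp add: subspace_diff subspace_scale subspace_grading)
  ultimately have "Y y 1 v - c *s v = 0"
    by (rule translation_inj_degree_one[rotated])
  then show ?thesis by (simp add: one)
qed

lemma J1_funpow_degree:
  assumes "v \<in> V 1" "x \<in> V n"
  shows "((\<lambda>b. - Y v 1 b) ^^ k) x \<in> V (n - int k)"
proof (induction k)
  case 0
  then show ?case using assms by simp
next
  case (Suc k)
  show ?case
    using product_degree[OF assms(1) Suc.IH, of 1]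
    by (simp add: subspace_neg subspace_grading algebra_simps)
qed

text \<open>
  For $v(0) = 0$ the commutator formula reads $[v(1), x(n)] = (v(1)x)(n)$.
\<close>

lemma J1_locally_nilpotent_derivation:
  assumes "v \<in> J1 Y V"
  shows "locally_nilpotent_derivation scale Y vac (\<lambda>b. - Y v 1 b)"
proof
  have v: "v \<in> V 1" "\<And>w. Y v 0 w = 0"
    using assms by (auto simp: J1_def)
  let ?f = "\<lambda>b. - Y v 1 b"
  show "?f (x + y) = ?f x + ?f y" "?f (c *s x) = c *s ?f x" for x y c
    by simp_all
  show "?f (Y x n y) = Y (?f x) n y + Y x n (?f y)" for x n y
    using commutator_one[of v x n y] v(2) by (simp add: algebra_simps)
  have f_sum: "(?f ^^ k) (\<Sum>i\<in>I. h i) = (\<Sum>i\<in>I. (?f ^^ k) (h i))" for k h and I :: "int set"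
    by (induction k) (simp_all add: sum_negf)
  show "\<exists>N. (?f ^^ N) x = 0" for x
  proof -
    obtain M where M: "{n. proj V n x \<noteq> 0} \<subseteq> {..<M}"
      using finite_proj[of x] by (metis bdd_above_finite bdd_above.E lessThan_iff subsetI zle_add1_eq_le)
    have "(?f ^^ nat M) x = (\<Sum>n | proj V n x \<noteq> 0. (?f ^^ nat M) (proj V n x))"
      by (subst sum_proj[of x, symmetric]) (rule f_sum)
    also have "\<dots> = 0"
      by (intro sum.neutral ballI negative_degree[OF J1_funpow_degree[OF v(1) proj_in]])
        (use M in auto)
    finally show ?thesis by blast
  qed
qed

lemma conformal_vector_exp:
  assumes a: "a \<in> CV scale Y vac"
  shows "proj V 1 a \<in> J1 Y V"
    and "exp_op scale (\<lambda>b. - Y (proj V 1 a) 1 b) a \<in> CV scale Y vac"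
    and "exp_op scale (\<lambda>b. - Y (proj V 1 a) 1 b) a \<in> V_ge scale V 2"
proof -
  interpret A: conformal_vertex_algebra scale Y vac "\<lambda>n. {v. Y a 1 v = of_int n *s v}" a
    using a by (simp add: CV_def)
  define v where "v = proj V 1 a"
  have zeroth: "Y (proj V n a) 0 w = (if n = 2 then Y w (-2) vac else 0)" for n w
    by (rule proj_zeroth_product) (rule A.Lm1_translation)
  have v: "v \<in> V 1" "\<And>w. Y v 0 w = 0"
    by (simp_all add: v_def proj_in zeroth)
  then have J1: "v \<in> J1 Y V" by (simp add: J1_def)
  interpret f: locally_nilpotent_derivation scale Y vac "\<lambda>b. - Y v 1 b"
    by (rule J1_locally_nilpotent_derivation[OF J1])
  let ?f = "\<lambda>b. - Y v 1 b"
  define b where "b = exp_op scale ?f a"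
  have bCV: "b \<in> CV scale Y vac"
    unfolding b_def by (rule f.expf_CV[OF a])
  have proj_f: "proj V n ((?f ^^ k) x) = (?f ^^ k) (proj V (n + int k) x)" for n k x
    by (induction k arbitrary: n)
      (simp_all add: proj.neg proj_prod_homogeneous_left[OF v(1)] algebra_simps)
  have b1: "proj V 1 b = 0"
  proof -
    obtain N where N: "\<And>k. k \<ge> N \<Longrightarrow> (?f ^^ k) a = 0"
      by (metis f.eventually_zero)
    \<comment> \<open>The bound is at least two, so that the terms $k = 0$ and $k = 1$, which cancel, are present.\<close>
    have "b = (\<Sum>k<max N 2. f.dpow k a)"
      unfolding b_def by (rule f.expf_eq_sum) (simp add: N)
    then have "proj V 1 b = (\<Sum>k<max N 2. (1 / fact k) *s (?f ^^ k) (proj V (1 + int k) a))"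
      by (simp only: proj.sum f.dpow_def proj.scale proj_f)
    also have "\<dots> = (\<Sum>k\<in>{0,1}. (1 / fact k) *s (?f ^^ k) (proj V (1 + int k) a))"
    proof (rule sum.mono_neutral_right)
      show "\<forall>k\<in>{..<max N 2} - {0, 1}. (1 / fact k) *s (?f ^^ k) (proj V (1 + int k) a) = 0"
      proof
        fix k assume "k \<in> {..<max N 2} - {0, 1}"
        then obtain j where k: "k = Suc j" and j: "j \<noteq> 0" by (cases k) auto
        let ?y = "(?f ^^ j) (proj V (1 + int k) a)"
        have "?y \<in> V 2"
          using J1_funpow_degree[OF v(1) proj_in, of j "1 + int k" a] by (simp add: k)
        moreover have "Y ((?f ^^ i) (proj V (1 + int k) a)) 0 w = 0" for i w
        proof (induction i arbitrary: w)
          case 0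
          show ?case using j by (simp add: zeroth k)
        next
          case (Suc i)
          show ?case
            using f.derivation[of "(?f ^^ i) (proj V (1 + int k) a)" 0 w] by (simp add: Suc.IH)
        qed
        ultimately have "Y v 1 ?y = 0 *s v"
          by (intro first_product_degree_two v) simp_all
        then show "(1 / fact k) *s (?f ^^ k) (proj V (1 + int k) a) = 0"
          by (simp add: k)
      qed
    qed auto
    also have "\<dots> = v - Y v 1 (proj V 2 a)"
      by (simp add: v_def)
    also have "Y v 1 (proj V 2 a) = 1 *s v"
      by (intro first_product_degree_two v) (simp_all add: proj_in zeroth)
    finally show ?thesis by simp
  qed
  have b0: "proj V 0 b = 0"
  proof -
    interpret B: conformal_vertex_algebra scale Y vac "\<lambda>n. {v. Y b 1 v = of_int n *s v}" b
      using bCV by (simp add: CV_def)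
    have summand: "Y (proj V (2 - m) b) 1 (proj V m b) = 0" for m
    proof -
      consider "m < 0" | "m = 0" | "m = 1" | "m = 2" | "2 - m < 0" by linarith
      then show ?thesis
      proof cases
        case 2
        then obtain c where "proj V m b = c *s vac"
          using degree_zero proj_in by metis
        then show ?thesis by (simp add: creation_nonneg)
      next
        case 4
        then obtain c where "proj V (2 - m) b = c *s vac"
          using degree_zero proj_in by (metis diff_self)
        then show ?thesis by (simp add: vacuum)
      qed (use negative_degree[OF proj_in, of _ b] b1 in auto)
    qed
    have "2 *s b = Y b 1 b"
      using B.conformal_degree by simp
    then have "2 *s proj V 0 b = proj V 0 (Y b 1 b)"
      by (metis proj.scale)
    also have "\<dots> = (\<Sum>m | proj V m b \<noteq> 0. proj V 0 (Y b 1 (proj V m b)))"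
      by (subst (2) sum_proj[of b, symmetric]) (simp only: prod_sum_right proj.sum)
    also have "\<dots> = (\<Sum>m | proj V m b \<noteq> 0. Y (proj V (2 - m) b) 1 (proj V m b))"
      by (simp add: proj_prod_homogeneous_right[OF proj_in])
    also have "\<dots> = 0"
      by (simp only: summand sum.neutral_const)
    finally show ?thesis by simp
  qed
  have "b \<in> V_ge scale V 2"
  proof -
    have "(\<Sum>n | proj V n b \<noteq> 0. proj V n b) \<in> span (\<Union>i\<in>{2..}. V i)"
    proof (intro span_sum span_base)
      fix n assume n: "n \<in> {n. proj V n b \<noteq> 0}"
      have "n \<ge> 2"
      proof (rule ccontr)
        assume "\<not> n \<ge> 2"
        then consider "n < 0" | "n = 0" | "n = 1" by linarith
        then show False
          by cases (use n b0 b1 negative_degree[OF proj_in, of n b] in auto)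
      qed
      then show "proj V n b \<in> (\<Union>i\<in>{2..}. V i)"
        using proj_in by blast
    qed
    then show ?thesis by (simp add: V_ge_def sum_proj)
  qed
  then show "proj V 1 a \<in> J1 Y V" "exp_op scale (\<lambda>b. - Y (proj V 1 a) 1 b) a \<in> CV scale Y vac"
    "exp_op scale (\<lambda>b. - Y (proj V 1 a) 1 b) a \<in> V_ge scale V 2"
    using J1 bCV unfolding v_def b_def by simp_all
qed

end

theorem lemma4p4:
  fixes scale :: "'k::real_or_complex \<Rightarrow> 'v::ab_group_add \<Rightarrow> 'v"
    and Y :: "'v \<Rightarrow> int \<Rightarrow> 'v \<Rightarrow> 'v"
    and vac \<omega> a :: 'v
    and V :: "int \<Rightarrow> 'v set"
  assumes "CFT_type_VOA scale Y vac V \<omega>"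
    and "a \<in> CV scale Y vac"
  shows "proj V 1 a \<in> J1 Y V
    \<and> exp_op scale (\<lambda>b. - Y (proj V 1 a) 1 b) a \<in> V_ge scale V 2 \<inter> CV scale Y vac"
proof -
  interpret CFT_type_VOA scale Y vac V \<omega> by (rule assms(1))
  show ?thesis using conformal_vector_exp[OF assms(2)] by blast
qed

end
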